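(* Let $a,c\in\mathbb R$ with $a<c$, let $L>0$, and let $h:[a,c]\to\mathbb R$ be an $L$-Lipschitz mapping such that $h(x)>x$ for each $x\in[a,c)$ and $c$ is the unique fixed point of $h$ in $[a,c]$. Let $x_0\in[a,c]$ and, for each $n\ge 0$, define $$x_{n+1}=(1-t)x_n+t\,h(x_n).$$ Then for each $0<t\le\frac{1}{1+L}$ the sequence $\{x_n\}$ converges to $c$.
   Context: A function $h:[a,c]\to\mathbb R$ is called $L$-Lipschitz (for $L>0$) if $|h(x)-h(y)|\le L|x-y|$ for all $x,y\in[a,c]$. A fixed point of $h$ is a point $x$ of its domain with $h(x)=x$. Note that $h$ is not assumed to map $[a,c]$ into itself; that the iterates remain in $[a,c]$ (so that the recursion is well defined) is understood as part of the assertion. *)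

theory Defs
  imports "HOL-Analysis.Analysis"
begin

end

theory Submission imports Defs begin

text \<open>
  The bound on \<open>t\<close> is what prevents the iteration from overshooting \<open>c\<close>: since
  \<open>h y - c \<le> L * (c - y)\<close>, the averaged point exceeds \<open>c\<close> by at most
  \<open>(t * (1 + L) - 1) * (c - y) \<le> 0\<close>. Hence the iterates increase inside \<open>[a, c]\<close>, and by
  continuity their limit is a fixed point of \<open>h\<close>.
\<close>

theorem lemma2p1:
  fixes a c L t :: real and h :: "real \<Rightarrow> real" and x :: "nat \<Rightarrow> real"
  assumes "a < c"
    and "L > 0"
    and "L-lipschitz_on {a..c} h"
    and "\<And>y. y \<in> {a..<c} \<Longrightarrow> h y > y"
    and "{y \<in> {a..c}. h y = y} = {c}"
    and "x 0 \<in> {a..c}"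
    and "\<And>n. x (Suc n) = (1 - t) * x n + t * h (x n)"
    and "0 < t"
    and "t \<le> 1 / (1 + L)"
  shows "(\<forall>n. x n \<in> {a..c}) \<and> x \<longlonglongrightarrow> c"
proof -
  have hc: "h c = c"
    using assms(5) by blast
  have tL: "t * (1 + L) \<le> 1"
    using assms(2,9) by (simp add: field_simps)
  \<comment> \<open>The strict inequality stops short of \<open>c\<close>; there the fixed point
    gives equality.\<close>
  have above: "y \<le> h y" if "y \<in> {a..c}" for y
    using assms(4)[of y] hc that by (cases "y = c") auto
  have step_ge: "y \<le> (1 - t) * y + t * h y" if "y \<in> {a..c}" for y
    using mult_left_mono[OF above[OF that], of t] assms(8) by (simp add: algebra_simps)
  have step_le: "(1 - t) * y + t * h y \<le> c" if y: "y \<in> {a..c}" for y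
  proof -
    have "h y - c \<le> L * (c - y)"
      using lipschitz_onD[OF assms(3) y, of c] y assms(1) hc by (simp add: dist_real_def)
    then have "t * (h y - c) \<le> t * (L * (c - y))"
      using assms(8) by (intro mult_left_mono) auto
    \<comment> \<open>Added to the previous bound, the terms \<open>t * L * (c - y)\<close> cancel,
      leaving \<open>t * (h y - c) \<le> (1 - t) * (c - y)\<close>, which rearranges to the
      goal.\<close>
    moreover have "t * (1 + L) * (c - y) \<le> 1 * (c - y)"
      using tL y by (intro mult_right_mono) auto
    ultimately show ?thesis
      by (simp add: algebra_simps)
  qed
  have mem: "x n \<in> {a..c}" for n
  proof (induction n)
    case 0
    show ?case by (rule assms(6))
  next
    case (Suc n)
    then show ?case
      using step_ge[OF Suc] step_le[OF Suc] by (simp add: assms(7))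
  qed
  have "incseq x"
    using step_ge[OF mem] by (intro incseq_SucI) (simp add: assms(7))
  then obtain l where l: "x \<longlonglongrightarrow> l"
    using incseq_convergent[of x c] mem by (metis atLeastAtMost_iff)
  \<comment> \<open>Continuity of \<open>h\<close> is known only on \<open>{a..c}\<close>, so the
    limit must be placed there first.\<close>
  have l_mem: "l \<in> {a..c}"
    using closed_sequentially[OF closed_real_atLeastAtMost] mem l by blast
  have "(\<lambda>n. h (x n)) \<longlonglongrightarrow> h l"
    using continuous_on_tendsto_compose[OF lipschitz_on_continuous_on[OF assms(3)] l l_mem] mem
    by simp
  then have "(\<lambda>n. (1 - t) * x n + t * h (x n)) \<longlonglongrightarrow> (1 - t) * l + t * h l"
    by (intro tendsto_intros l)
  \<comment> \<open>By the recursion this sequence is \<open>x\<close> shifted by one, so it has the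
    same limit \<open>l\<close>.\<close>
  moreover have "(\<lambda>n. (1 - t) * x n + t * h (x n)) \<longlonglongrightarrow> l"
    using LIMSEQ_Suc[OF l] by (simp add: assms(7))
  ultimately have "(1 - t) * l + t * h l = l"
    by (rule LIMSEQ_unique)
  then have "t * (h l - l) = 0"
    by (simp add: algebra_simps)
  then have "h l = l"
    using assms(8) by simp
  then have "l = c"
    using l_mem assms(5) by blast
  then show ?thesis
    using mem l by blast
qed

end
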